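(* Let $\mathcal{T}_r=(\mathcal{V},\mathcal{E}_r)$ be a rooted directed tree with $\mathcal{V}=\{1,\dots,J\}$, set of leaves $\mathcal{L}$ and root $r=1\in\mathcal{L}$. Let $A^{(j_1,j_2)}\in\mathbb{R}^{n\times n}$, $(j_1,j_2)\in\mathcal{E}_r$, be probability transition (row-stochastic) matrices with strictly positive elements, and let $\mu_j\in\mathbb{R}_+^n$, $j\in\mathcal{L}$, be given with $\mathbf{1}^T\mu_{j_1}=\mathbf{1}^T\mu_{j_2}$ for all leaves $j_1,j_2\in\mathcal{L}$. Then an optimal solution to the tree-structured Schrödinger bridge problem $$\min\ \sum_{(j_1,j_2)\in\mathcal{E}_r}H\big(M^{(j_1,j_2)}\,|\,\mathrm{diag}(\mu_{j_1})A^{(j_1,j_2)}\big)\quad\text{s.t.}\quad M^{(j_1,j_2)}\mathbf{1}=\mu_{j_1},\ (M^{(j_1,j_2)})^T\mathbf{1}=\mu_{j_2}\ \ \forall (j_1,j_2)\in\mathcal{E}_r,$$ where the minimization is over $M^{(j_1,j_2)}\in\mathbb{R}_+^{n\times n}$, $(j_1,j_2)\in\mathcal{E}_r$, and $\mu_j\in\mathbb{R}_+^n$, $j\in\mathcal{V}\setminus\mathcal{L}$, can be written as $$\mu_j=\varphi_j\odot\hat\varphi_j,\qquad M^{(j_1,j_2)}=\mathrm{diag}(\hat\varphi_{j_1}\odot\varphi_{j_1\setminus j_2})\,A^{(j_1,j_2)}\,\mathrm{diag}(\varphi_{j_2}),$$ for a set of vectors $\varphi_j,\hat\varphi_j$,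 $j\in\mathcal{V}$, and $\varphi_{j_1\setminus j_2}$, $(j_1,j_2)\in\mathcal{E}_r$. Moreover, there exists a set of vectors $v_j$, $j\in\mathcal{L}$, such that the vectors $\varphi_j$, $\hat\varphi_j$ and $\varphi_{j_1\setminus j_2}$ can be written as $$\varphi_j=\begin{cases}v_j,& j\in\mathcal{L}\setminus\{1\},\\ \bigodot_{k:(j,k)\in\mathcal{E}_r}A^{(j,k)}\varphi_k,&\text{else,}\end{cases}\qquad \hat\varphi_j=\begin{cases}\mathbf{1}./v_1,& j=1,\\ (A^{(p(j),j)})^T(\hat\varphi_{p(j)}\odot\varphi_{p(j)\setminus j}),&\text{else,}\end{cases}$$ and $\varphi_{j_1\setminus j_2}=\varphi_{j_1}./\big(A^{(j_1,j_2)}\varphi_{j_2}\big)$.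
   Context: Elementwise operations: $\odot$, $\bigodot$ (product), $./$ (division); $\mathbf{1}$ is the all-ones vector. Leaves are vertices of degree 1. All edges in $\mathcal{E}_r$ are directed away from the root; for $j\ne1$, $p(j)$ denotes the parent of $j$, i.e. the unique vertex with $(p(j),j)\in\mathcal{E}_r$. For nonnegative arrays $p,q$ of the same dimensions, $H(p|q)=\sum_i\big(p_i\log(p_i/q_i)-p_i+q_i\big)$ with $0\log0=0$.
   Formalization: Elementwise division uses the convention x/0 = 0, so 1./v_1 may have zero entries; this is needed when μ_1 has zero entries (where v_1 would have to be infinite) or when the common mass is zero. *)

theory Defs
  imports "HOL-Analysis.Analysis"
begin

text \<open>
  On \<^typ>\<open>real ^ 'n\<close> the library operations \<open>*\<close>, \<open>\<Prod>\<close> and \<open>1\<close> are the elementwise product and the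
  all-ones vector, and \<open>\<le>\<close> is the elementwise order (also on matrices). Matrix products are \<open>**\<close>
  and \<open>*v\<close>.
\<close>

text \<open>
  Since \<open>x / 0 = 0\<close> in HOL, \<open>1 ./ v\<close> may have zero entries, namely where \<open>v\<close> does. For the root factor
  this replaces the conventional entry \<open>v $ i = \<infinity>\<close>, which is needed when the prescribed marginal at the
  root vanishes in \<open>i\<close>.
\<close>
definition vec_divide :: "real ^ 'n \<Rightarrow> real ^ 'n \<Rightarrow> real ^ 'n" (infixl \<open>.'/\<close> 70)
  where "x ./ y = (\<chi> i. x $ i / y $ i)"

definition diag :: "real ^ 'n \<Rightarrow> real ^ 'n ^ 'n"
  where "diag x = (\<chi> i j. if i = j then x $ i else 0)"

definition row_stochastic :: "real ^ 'n ^ 'n \<Rightarrow> bool"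
  where "row_stochastic P \<longleftrightarrow> 0 \<le> P \<and> P *v 1 = 1"

text \<open>
  The summand \<open>p log (p/q) - p + q\<close> of the relative entropy for \<open>p, q \<ge> 0\<close>, with \<open>0 log 0 = 0\<close> and the
  usual value \<open>\<infinity>\<close> for \<open>q = 0 < p\<close>.
\<close>
definition entropy_term :: "real \<Rightarrow> real \<Rightarrow> ereal"
  where "entropy_term p q =
    (if p = 0 then ereal q else if q = 0 then \<infinity> else ereal (p * ln (p / q) - p + q))"

definition rel_entropy :: "real ^ 'n ^ 'm \<Rightarrow> real ^ 'n ^ 'm \<Rightarrow> ereal"
  where "rel_entropy P Q = (\<Sum>i\<in>UNIV. \<Sum>j\<in>UNIV. entropy_term (P $ i $ j) (Q $ i $ j))"

text \<open>Finite directed trees whose edges all point away from the root \<open>r\<close>.\<close>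
definition rooted_tree :: "'v set \<Rightarrow> ('v \<times> 'v) set \<Rightarrow> 'v \<Rightarrow> bool"
  where "rooted_tree V E r \<longleftrightarrow> finite V \<and> r \<in> V \<and> E \<subseteq> V \<times> V \<and>
    (\<forall>j\<in>V. (r, j) \<in> E\<^sup>*) \<and> (\<forall>i. (i, r) \<notin> E) \<and> (\<forall>j\<in>V - {r}. \<exists>!i. (i, j) \<in> E)"

definition parent :: "('v \<times> 'v) set \<Rightarrow> 'v \<Rightarrow> 'v"
  where "parent E j = (THE i. (i, j) \<in> E)"

definition leaves :: "'v set \<Rightarrow> ('v \<times> 'v) set \<Rightarrow> 'v set"
  where "leaves V E = {j \<in> V. card {k. (j, k) \<in> E \<or> (k, j) \<in> E} = 1}"

text \<open>
  The marginals on the leaves are prescribed by \<open>\<mu>\<close>; the family \<open>\<nu>\<close> extends them by the marginals on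
  the inner vertices, over which one minimizes. Values of \<open>\<mu>\<close> off the leaves, of \<open>\<nu>\<close> off \<open>V\<close> and of
  \<open>M\<close> off \<open>E\<close> are irrelevant.
\<close>
definition sb_feasible ::
    "'v set \<Rightarrow> ('v \<times> 'v) set \<Rightarrow> ('v \<Rightarrow> real ^ 'n) \<Rightarrow> ('v \<Rightarrow> real ^ 'n) \<Rightarrow> ('v \<times> 'v \<Rightarrow> real ^ 'n ^ 'n) \<Rightarrow> bool"
  where "sb_feasible V E \<mu> \<nu> M \<longleftrightarrow>
    (\<forall>j\<in>leaves V E. \<nu> j = \<mu> j) \<and> (\<forall>j\<in>V - leaves V E. 0 \<le> \<nu> j) \<and>
    (\<forall>(j\<^sub>1, j\<^sub>2)\<in>E. 0 \<le> M (j\<^sub>1, j\<^sub>2) \<and>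
      M (j\<^sub>1, j\<^sub>2) *v 1 = \<nu> j\<^sub>1 \<and> transpose (M (j\<^sub>1, j\<^sub>2)) *v 1 = \<nu> j\<^sub>2)"

definition sb_cost ::
    "('v \<times> 'v) set \<Rightarrow> ('v \<times> 'v \<Rightarrow> real ^ 'n ^ 'n) \<Rightarrow> ('v \<Rightarrow> real ^ 'n) \<Rightarrow> ('v \<times> 'v \<Rightarrow> real ^ 'n ^ 'n) \<Rightarrow> ereal"
  where "sb_cost E A \<nu> M =
    (\<Sum>(j\<^sub>1, j\<^sub>2)\<in>E. rel_entropy (M (j\<^sub>1, j\<^sub>2)) (diag (\<nu> j\<^sub>1) ** A (j\<^sub>1, j\<^sub>2)))"

definition sb_optimal ::
    "'v set \<Rightarrow> ('v \<times> 'v) set \<Rightarrow> ('v \<times> 'v \<Rightarrow> real ^ 'n ^ 'n) \<Rightarrow> ('v \<Rightarrow> real ^ 'n)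
      \<Rightarrow> ('v \<Rightarrow> real ^ 'n) \<Rightarrow> ('v \<times> 'v \<Rightarrow> real ^ 'n ^ 'n) \<Rightarrow> bool"
  where "sb_optimal V E A \<mu> \<nu> M \<longleftrightarrow> sb_feasible V E \<mu> \<nu> M \<and>
    (\<forall>\<nu>' M'. sb_feasible V E \<mu> \<nu>' M' \<longrightarrow> sb_cost E A \<nu> M \<le> sb_cost E A \<nu>' M')"

end

theory Submission
  imports Defs
begin

text \<open>
  Given vectors \<open>v\<close> on the leaves other than the root, \<open>\<phi>\<close> is computed from the leaves up to the root and
  \<open>\<phi>h\<close> from the root down. Replacing the reference \<open>q\<close> by \<open>q c\<close> in the entropy terms, where
  \<open>c = \<phi> j $ y / (A *v \<phi> j) $ x\<close> keeps the transition matrix stochastic, bounds the cost of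
  every feasible plan from below by terms \<open>M ln c\<close>. They telescope along the tree to the dual value
  \<open>\<Sum>l. \<mu> l \<bullet> ln (v l) - \<mu> r \<bullet> ln (\<phi> r)\<close>, which involves only the prescribed marginals, and the bound
  is attained by the plan built from \<open>\<phi>\<close> and \<open>\<phi>h\<close>. That plan is feasible once \<open>v l * \<phi>h l = \<mu> l\<close> at
  every leaf \<open>l\<close> other than the root. As \<open>\<phi> r\<close> is linear in each \<open>v l\<close>, with gradient given by \<open>\<phi>h l\<close>,
  these equations say that \<open>v\<close> is a critical point of the dual value; a maximizer exists because the
  leaf masses agree, so that each \<open>v l\<close> may be normalized to a simplex.
\<close>

section \<open>Entrywise formulas and the entropy inequality\<close>

lemma vec_divide_component [simp]: "(x ./ y) $ i = x $ i / y $ i"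
  by (simp add: vec_divide_def)

lemma prod_component [simp]: "prod f S $ i = (\<Prod>k\<in>S. f k $ i)"
  for f :: "'b \<Rightarrow> real ^ 'n"
  by (induction S rule: infinite_finite_induct) auto

lemma matrix_vector_mult_nth: "(P *v x) $ i = (\<Sum>j\<in>UNIV. P $ i $ j * x $ j)"
  for P :: "real ^ 'n ^ 'm"
  by (simp add: matrix_vector_mult_def)

lemma transpose_mult_nth: "(transpose P *v x) $ j = (\<Sum>i\<in>UNIV. P $ i $ j * x $ i)"
  for P :: "real ^ 'n ^ 'm"
  by (simp add: matrix_vector_mult_def transpose_def)

lemma diag_mult_nth: "(diag x ** P) $ i $ j = x $ i * P $ i $ j"
  by (simp add: diag_def matrix_matrix_mult_def if_distrib[of "\<lambda>y. y * _"] cong: if_cong)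

lemma mult_diag_nth: "(P ** diag x) $ i $ j = P $ i $ j * x $ j"
  by (simp add: diag_def matrix_matrix_mult_def if_distrib[of "\<lambda>y. _ * y"] cong: if_cong)

lemma positive_matrix_mult_pos:
  fixes P :: "real ^ 'n ^ 'm"
  assumes "\<And>i j. 0 < P $ i $ j" "0 \<le> w" "w \<noteq> 0"
  shows "0 < (P *v w) $ i"
proof -
  obtain j where "w $ j \<noteq> 0"
    using assms(3) by (auto simp: vec_eq_iff)
  then have "0 < P $ i $ j * w $ j"
    using assms(1)[of i j] assms(2) by (simp add: less_eq_vec_def order_less_le)
  moreover have "0 \<le> P $ i $ k * w $ k" for k
    using assms(1)[of i k] assms(2) by (simp add: less_eq_vec_def)
  ultimately show ?thesis
    unfolding matrix_vector_mult_nth by (intro sum_pos2[of _ j]) auto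
qed

text \<open>This is Fenchel's inequality for the entropy with dual variable \<open>ln c\<close>,
  obtained from \<open>ln z \<le> z - 1\<close> at \<open>z = q * c / p\<close>. The condition at
  \<open>c = 0\<close> is needed because \<open>ln 0\<close> is a real number in HOL, where the
  bound calls for minus infinity.\<close>

lemma entropy_term_ge:
  assumes "0 \<le> p" "0 \<le> q" "0 \<le> c" "c = 0 \<Longrightarrow> p = 0"
  shows "ereal (p * ln c + q - q * c) \<le> entropy_term p q"
proof (cases "p = 0 \<or> q = 0")
  case True
  then show ?thesis using assms by (auto simp: entropy_term_def)
next
  case False
  then have pos: "p > 0" "q > 0" "c > 0" using assms by (auto simp: order_less_le)
  have "ln (q * c / p) \<le> q * c / p - 1"
    using pos by (intro ln_le_minus_one) simp
  then have "p * ln (q * c / p) \<le> q * c - p"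
    using pos mult_left_mono[of _ _ p] by (fastforce simp: algebra_simps)
  then show ?thesis
    using pos by (simp add: entropy_term_def ln_div ln_mult algebra_simps)
qed

text \<open>The equality case of \<open>entropy_term_ge\<close>, which makes the dual bound
  tight.\<close>

lemma entropy_term_eq:
  assumes "0 \<le> q" "0 \<le> c"
  shows "entropy_term (q * c) q = ereal (q * c * ln c + q - q * c)"
  using assms by (auto simp: entropy_term_def)

section \<open>Vectors propagated along a tree\<close>

locale tree_bridge =
  fixes V :: "'v set" and E :: "('v \<times> 'v) set" and r :: 'v
    and A :: "'v \<times> 'v \<Rightarrow> real ^ 'n ^ 'n"
  assumes tree: "rooted_tree V E r"
    and root_leaf: "r \<in> leaves V E"
    and stochastic: "\<And>e. e \<in> E \<Longrightarrow> row_stochastic (A e)"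
    and positive: "\<And>e i j. e \<in> E \<Longrightarrow> 0 < A e $ i $ j"
begin

section \<open>Structure of the rooted tree\<close>

lemma finite_V: "finite V" and E_sub: "E \<subseteq> V \<times> V" and root_in: "r \<in> V"
  and reachable: "\<And>j. j \<in> V \<Longrightarrow> (r, j) \<in> E\<^sup>*" and no_edge_to_root: "(i, r) \<notin> E"
  and ex1_parent: "\<And>j. j \<in> V \<Longrightarrow> j \<noteq> r \<Longrightarrow> \<exists>!i. (i, j) \<in> E"
  using tree by (auto simp: rooted_tree_def)

lemma finite_E: "finite E"
  using finite_V E_sub finite_subset by blast

lemma edgeD:
  assumes "(i, j) \<in> E"
  shows "i \<in> V" "j \<in> V" "j \<noteq> r" "parent E j = i"
proof -
  show 1: "i \<in> V" "j \<in> V" "j \<noteq> r"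
    using assms E_sub no_edge_to_root by auto
  show "parent E j = i"
    unfolding parent_def using ex1_parent[OF 1(2,3)] assms by (blast intro: the1_equality)
qed

lemma parent_edge: "j \<in> V \<Longrightarrow> j \<noteq> r \<Longrightarrow> (parent E j, j) \<in> E"
  using ex1_parent edgeD(4) by metis

lemma single_valued_converse: "single_valued (E\<inverse>)"
  using edgeD(4) by (auto intro!: single_valuedI)

text \<open>Parents are unique, so a cycle through a vertex also passes through its parent.
  Following parents, the cycle would reach the root, which has no incoming edge.\<close>

lemma acyclic_E: "acyclic E"
proof (rule acyclicI, safe)
  fix x assume cyc: "(x, x) \<in> E\<^sup>+"
  have step: "(i, i) \<in> E\<^sup>+" if "(i, j) \<in> E" "(j, j) \<in> E\<^sup>+" for i j
  proof -
    obtain k where "(j, k) \<in> E\<^sup>*" "(k, j) \<in> E" using \<open>(j, j) \<in> E\<^sup>+\<close> by (meson tranclD2)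
    then have "k = i" using that(1) edgeD(4) by metis
    then show ?thesis using that(1) \<open>(j, k) \<in> E\<^sup>*\<close> by (meson rtrancl_into_trancl2)
  qed
  have "x \<in> V" using cyc E_sub by (meson edgeD(1) tranclD)
  from reachable[OF this] have "(r, r) \<in> E\<^sup>+"
    using cyc by (induction rule: rtrancl_induct) (auto intro: step)
  then show False using no_edge_to_root by (meson tranclD2)
qed

lemma wf_E: "wf E"
  using finite_E acyclic_E by (rule finite_acyclic_wf)

lemma wf_converse_E: "wf (E\<inverse>)"
  using finite_E acyclic_E by (rule finite_acyclic_wf_converse)

lemma tree_induct [consumes 1, case_names root edge]:
  assumes "j \<in> V" "P r" "\<And>i j. (i, j) \<in> E \<Longrightarrow> P i \<Longrightarrow> P j"
  shows "P j"
  using reachable[OF assms(1)] assms(2,3) by (induction rule: rtrancl_induct) auto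

text \<open>With unique parents the ancestors of \<open>l\<close> form a chain, so one child would
  lie below the other. The path between them enters the lower one through its only parent
  \<open>j\<close> and closes a cycle.\<close>

lemma children_descendants_disjoint:
  assumes "(j, k) \<in> E" "(j, k') \<in> E" "(k, l) \<in> E\<^sup>*" "(k', l) \<in> E\<^sup>*"
  shows "k = k'"
proof -
  have *: "a = b" if "(j, a) \<in> E" "(j, b) \<in> E" "(a, b) \<in> E\<^sup>*" for a b
  proof (rule ccontr)
    assume "a \<noteq> b"
    then obtain p where p: "(a, p) \<in> E\<^sup>*" "(p, b) \<in> E" using \<open>(a, b) \<in> E\<^sup>*\<close> by (metis rtranclE)
    then have "(a, j) \<in> E\<^sup>*" using \<open>(j, b) \<in> E\<close> edgeD(4) by metis
    then have "(j, j) \<in> E\<^sup>+" using \<open>(j, a) \<in> E\<close> by (meson rtrancl_into_trancl2)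
    then show False using acyclic_E by (auto simp: acyclic_def)
  qed
  have "(k, k') \<in> E\<^sup>* \<or> (k', k) \<in> E\<^sup>*"
    using single_valued_confluent[OF single_valued_converse, of l k k'] assms(3,4)
    by (auto simp: rtrancl_converse)
  then show ?thesis using * assms(1,2) by metis
qed

section \<open>The recursions for the vectors of the theorem\<close>

definition terminals :: "'v set"
  where "terminals = leaves V E - {r}"

lemma terminals_sub: "terminals \<subseteq> V" and root_not_terminal: "r \<notin> terminals"
  and finite_terminals: "finite terminals"
  using finite_V by (auto simp: terminals_def leaves_def)

text \<open>The parent is already the only neighbour, so a child would coincide with it and close a
  cycle of length two.\<close>

lemma terminal_no_child:
  assumes "j \<in> terminals"
  shows "(j, k) \<notin> E"
proof
  assume k: "(j, k) \<in> E"
  let ?N = "{k. (j, k) \<in> E \<or> (k, j) \<in> E}"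
  have "parent E j \<in> ?N" "k \<in> ?N" "card ?N = 1"
    using assms k parent_edge[of j] by (auto simp: terminals_def leaves_def)
  then have "parent E j = k" by (metis card_1_singletonE singletonD)
  then have "(j, j) \<in> E\<^sup>+"
    using k parent_edge[of j] assms by (auto simp: terminals_def leaves_def intro: trancl_into_trancl)
  then show False using acyclic_E by (auto simp: acyclic_def)
qed

text \<open>These are the vectors \<phi>. The recursion runs from children to parents, along the
  converse of \<open>E\<close>, which is well-founded because the tree is finite and
  acyclic.\<close>

definition upward :: "('v \<Rightarrow> real ^ 'n) \<Rightarrow> 'v \<Rightarrow> real ^ 'n"
  where "upward v = wfrec (E\<inverse>)
    (\<lambda>f j. if j \<in> terminals then v j else \<Prod>k\<in>{k. (j, k) \<in> E}. A (j, k) *v f k)"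

lemma upward_terminal: "j \<in> terminals \<Longrightarrow> upward v j = v j"
  unfolding upward_def by (subst wfrec[OF wf_converse_E]) simp

lemma upward_inner:
  assumes "j \<notin> terminals"
  shows "upward v j = (\<Prod>k\<in>{k. (j, k) \<in> E}. A (j, k) *v upward v k)"
  using assms unfolding upward_def
  by (subst wfrec[OF wf_converse_E]) (auto simp: cut_def intro!: prod.cong)

definition message :: "('v \<Rightarrow> real ^ 'n) \<Rightarrow> 'v \<times> 'v \<Rightarrow> real ^ 'n"
  where "message v = (\<lambda>(i, j). upward v i ./ (A (i, j) *v upward v j))"

text \<open>These are the vectors \<open>\<phi>h\<close>. The root value \<open>u\<close> stays free
  here; later it is \<open>\<mu> r ./ upward v r\<close>, which gives the product with
  \<open>upward\<close> the prescribed marginal at the root.\<close>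

definition downward :: "('v \<Rightarrow> real ^ 'n) \<Rightarrow> real ^ 'n \<Rightarrow> 'v \<Rightarrow> real ^ 'n"
  where "downward v u = wfrec E
    (\<lambda>f j. if j = r then u
      else transpose (A (parent E j, j)) *v (f (parent E j) * message v (parent E j, j)))"

lemma downward_root: "downward v u r = u"
  unfolding downward_def by (subst wfrec[OF wf_E]) simp

lemma downward_edge:
  assumes "(i, j) \<in> E"
  shows "downward v u j = transpose (A (i, j)) *v (downward v u i * message v (i, j))"
  using assms edgeD[OF assms] unfolding downward_def
  by (subst wfrec[OF wf_E]) (simp add: cut_def)

text \<open>Zero entries of \<open>v\<close> have to be allowed, as they correspond to zeros of the leaf marginals.\<close>
definition admissible :: "('v \<Rightarrow> real ^ 'n) \<Rightarrow> bool"
  where "admissible v \<longleftrightarrow> (\<forall>l\<in>terminals. 0 \<le> v l \<and> v l \<noteq> 0)"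

text \<open>A strictly positive matrix sends a nonzero nonnegative vector to a strictly positive
  one, and products keep this. Zeros can therefore occur only at terminals.\<close>

lemma upward_semipos:
  assumes "admissible v"
  shows "0 \<le> upward v j \<and> upward v j \<noteq> 0 \<and> (j \<notin> terminals \<longrightarrow> (\<forall>i. 0 < upward v j $ i))"
proof (induction j rule: wf_induct_rule[OF wf_converse_E])
  case (1 j)
  show ?case
  proof (cases "j \<in> terminals")
    case True
    then show ?thesis using assms by (simp add: admissible_def upward_terminal)
  next
    case False
    have "0 < upward v j $ i" for i
      unfolding upward_inner[OF False] using 1 positive
      by (auto intro!: prod_pos positive_matrix_mult_pos)
    then show ?thesis by (auto simp: less_eq_vec_def less_imp_le)
  qed
qed

lemma upward_nonneg: "admissible v \<Longrightarrow> 0 \<le> upward v j $ i"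
  using upward_semipos by (simp add: less_eq_vec_def)

lemma upward_pos: "admissible v \<Longrightarrow> j \<notin> terminals \<Longrightarrow> 0 < upward v j $ i"
  using upward_semipos by blast

lemma edge_upward_pos:
  "admissible v \<Longrightarrow> (i, j) \<in> E \<Longrightarrow> 0 < (A (i, j) *v upward v j) $ x"
  using upward_semipos positive by (blast intro: positive_matrix_mult_pos)

lemma message_nonneg: "admissible v \<Longrightarrow> (i, j) \<in> E \<Longrightarrow> 0 \<le> message v (i, j) $ x"
  using edge_upward_pos[of v i j x] upward_nonneg[of v i x] by (simp add: message_def)

lemma downward_nonneg:
  assumes "admissible v" "0 \<le> u" "j \<in> V"
  shows "0 \<le> downward v u j"
  using assms(3)
proof (induction rule: tree_induct)
  case root
  then show ?case using assms(2) by (simp add: downward_root)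
next
  case (edge i j)
  then show ?case
    using message_nonneg[OF assms(1)] positive
    by (auto simp: less_eq_vec_def downward_edge[OF edge(1)] transpose_mult_nth less_imp_le
        simp del: transpose_matrix_vector intro!: sum_nonneg mult_nonneg_nonneg)
qed

lemma continuous_upward: "continuous_on UNIV (\<lambda>v. upward v j $ i)"
proof (induction j arbitrary: i rule: wf_induct_rule[OF wf_converse_E])
  case (1 j)
  show ?case
  proof (cases "j \<in> terminals")
    case True
    then show ?thesis by (simp add: upward_terminal continuous_intros)
  next
    case False
    show ?thesis
      unfolding upward_inner[OF False] prod_component matrix_vector_mult_nth
      using 1 by (intro continuous_on_prod continuous_on_sum continuous_on_mult continuous_on_const) auto
  qed
qed

section \<open>Dependence on a single leaf vector\<close>

lemma upward_upd_other:
  assumes "(j, l) \<notin> E\<^sup>*"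
  shows "upward (v(l := w)) j = upward v j"
  using assms
proof (induction j rule: wf_induct_rule[OF wf_converse_E])
  case (1 j)
  show ?case
  proof (cases "j \<in> terminals")
    case True
    then show ?thesis using 1(2) by (auto simp: upward_terminal)
  next
    case False
    have "upward (v(l := w)) k = upward v k" if "(j, k) \<in> E" for k
      using that 1 by (meson converse_iff converse_rtrancl_into_rtrancl)
    then show ?thesis by (simp add: upward_inner[OF False] del: fun_upd_apply)
  qed
qed

text \<open>Subtrees of different children are disjoint, so only the factor of the child above
  \<open>l\<close> notices the update.\<close>

lemma upward_upd_step:
  assumes "(j, k) \<in> E" "(k, l) \<in> E\<^sup>*"
  shows "upward (v(l := w)) j =
    (A (j, k) *v upward (v(l := w)) k) * (\<Prod>k'\<in>{k'. (j, k') \<in> E} - {k}. A (j, k') *v upward v k')"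
proof -
  have inner: "j \<notin> terminals" using assms(1) terminal_no_child by blast
  have fin: "finite {k'. (j, k') \<in> E}"
    using finite_V E_sub by (auto intro: finite_subset)
  have "upward (v(l := w)) k' = upward v k'" if "(j, k') \<in> E" "k' \<noteq> k" for k'
    using that assms children_descendants_disjoint upward_upd_other by metis
  then show ?thesis
    using assms(1) fin by (simp add: upward_inner[OF inner] prod.remove[of _ k])
qed

lemma linear_upward_upd:
  assumes "l \<in> terminals" "(j, l) \<in> E\<^sup>*"
  shows "linear (\<lambda>w. upward (v(l := w)) j)"
  using assms(2)
proof (induction rule: converse_rtrancl_induct)
  case base
  then show ?case by (simp add: upward_terminal assms(1) linear_id[unfolded id_def])
next
  case (step j k)
  show ?case
    unfolding upward_upd_step[OF step(1,2)]
    by (intro linearI)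
      (simp_all add: linear_add[OF step(3)] linear_scale[OF step(3)] matrix_vector_right_distrib
        matrix_vector_mult_scaleR distrib_right del: fun_upd_apply)
qed

text \<open>At each vertex on the path from \<open>j\<close> to \<open>l\<close> only one factor of the product depends on \<open>w\<close>, and the
  message collects the others.\<close>
lemma downward_duality:
  assumes "admissible v" "l \<in> terminals" "(j, l) \<in> E\<^sup>*"
  shows "downward v u j \<bullet> upward (v(l := w)) j = downward v u l \<bullet> w"
  using assms(3)
proof (induction rule: converse_rtrancl_induct)
  case base
  then show ?case by (simp add: upward_terminal assms(2))
next
  case (step j k)
  let ?d = "downward v u j" and ?P = "\<Prod>k'\<in>{k'. (j, k') \<in> E} - {k}. A (j, k') *v upward v k'"
  have msg: "message v (j, k) = ?P"
  proof -
    \<comment> \<open>Updating with the present value \<open>v l\<close> changes nothing, so this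
      factors \<open>upward v j\<close> itself.\<close>
    have "upward v j = (A (j, k) *v upward v k) * ?P"
      using upward_upd_step[OF step(1,2), of v "v l"] by simp
    then show ?thesis
      using edge_upward_pos[OF assms(1) step(1)]
      by (simp add: message_def vec_eq_iff) (metis less_irrefl nonzero_mult_div_cancel_left)
  qed
  \<comment> \<open>The fixed factors move to the left argument; then the matrix moves there as its
    transpose, which is the recursion for \<open>downward\<close>.\<close>
  have "?d \<bullet> upward (v(l := w)) j = (?d * ?P) \<bullet> (A (j, k) *v upward (v(l := w)) k)"
    unfolding upward_upd_step[OF step(1,2)] by (simp add: inner_vec_def mult_ac)
  also have "\<dots> = downward v u k \<bullet> upward (v(l := w)) k"
    by (simp add: downward_edge[OF step(1)] msg dot_lmul_matrix[symmetric] transpose_matrix_vector)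
  finally show ?case using step(3) by (simp del: fun_upd_apply)
qed

section \<open>Duality\<close>

lemma sum_edges: "(\<Sum>(i, j)\<in>E. f i j) = (\<Sum>i\<in>V. \<Sum>j\<in>{j. (i, j) \<in> E}. f i j)"
proof -
  have "finite {j. (i, j) \<in> E}" for i
    using finite_V E_sub by (auto intro: finite_subset)
  moreover have "E = Sigma V (\<lambda>i. {j. (i, j) \<in> E})" using E_sub by auto
  ultimately show ?thesis using finite_V by (simp add: sum.Sigma)
qed

text \<open>Each vertex other than the root is the head of exactly one edge.\<close>

lemma sum_edges_head: "(\<Sum>(i, j)\<in>E. g j) = sum g (V - {r})"
  by (rule sum.reindex_bij_witness[where j = snd and i = "\<lambda>j. (parent E j, j)"])
    (auto simp: parent_edge edgeD no_edge_to_root)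

definition dual_value :: "('v \<Rightarrow> real ^ 'n) \<Rightarrow> ('v \<Rightarrow> real ^ 'n) \<Rightarrow> real"
  where "dual_value \<mu> v = (\<Sum>l\<in>terminals. \<Sum>x\<in>UNIV. \<mu> l $ x * ln (v l $ x))
    - (\<Sum>x\<in>UNIV. \<mu> r $ x * ln (upward v r $ x))"

text \<open>The sum telescopes: summing the second term over the children of \<open>i\<close> gives \<open>ln (upward v i)\<close>.\<close>
lemma sum_edges_dual_value:
  assumes "admissible v" and marginals: "\<forall>j\<in>leaves V E. \<nu> j = \<mu> j"
  shows "(\<Sum>(i, j)\<in>E. (\<Sum>y\<in>UNIV. \<nu> j $ y * ln (upward v j $ y))
      - (\<Sum>x\<in>UNIV. \<nu> i $ x * ln ((A (i, j) *v upward v j) $ x))) = dual_value \<mu> v"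
    (is "(\<Sum>(i, j)\<in>E. ?h j - ?t i j) = _")
proof -
  have tails: "(\<Sum>j\<in>{j. (i, j) \<in> E}. ?t i j) = (if i \<in> terminals then 0 else ?h i)" for i
  proof (cases "i \<in> terminals")
    case True
    then show ?thesis using terminal_no_child by simp
  next
    case False
    have fin: "finite {j. (i, j) \<in> E}"
      using finite_V E_sub by (auto intro: finite_subset)
    have "ln (upward v i $ x) = (\<Sum>j\<in>{j. (i, j) \<in> E}. ln ((A (i, j) *v upward v j) $ x))" for x
      unfolding upward_inner[OF False] prod_component
      using fin edge_upward_pos[OF assms(1)] by (intro ln_prod) (auto simp: less_imp_neq[symmetric])
    then show ?thesis
      using False by (simp add: sum_distrib_left sum.swap[of _ UNIV "{j. (i, j) \<in> E}"])
  qed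
  have "(\<Sum>(i, j)\<in>E. ?h j - ?t i j) = (\<Sum>(i, j)\<in>E. ?h j) - (\<Sum>(i, j)\<in>E. ?t i j)"
    by (simp add: sum_subtractf case_prod_unfold)
  also have "\<dots> = sum ?h (V - {r}) - (\<Sum>i\<in>V. if i \<in> terminals then 0 else ?h i)"
    unfolding sum_edges_head sum_edges tails ..
  \<comment> \<open>Inner vertices occur both as heads and as tails and cancel. Terminals are only
    heads, and the root is only a tail.\<close>
  also have "\<dots> = (sum ?h terminals + sum ?h (V - leaves V E)) - (?h r + sum ?h (V - leaves V E))"
  proof -
    have "V - {r} = terminals \<union> (V - leaves V E)"
      using root_leaf by (auto simp: terminals_def leaves_def)
    then have 1: "sum ?h (V - {r}) = sum ?h terminals + sum ?h (V - leaves V E)"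
      using finite_V finite_terminals by (auto simp: terminals_def intro: sum.union_disjoint)
    have "(\<Sum>i\<in>V. if i \<in> terminals then 0 else ?h i) = sum ?h (V - terminals)"
      using finite_V by (intro sum.mono_neutral_cong_right) auto
    moreover have "V - terminals = insert r (V - leaves V E)"
      using root_leaf root_in by (auto simp: terminals_def)
    ultimately have "(\<Sum>i\<in>V. if i \<in> terminals then 0 else ?h i) = ?h r + sum ?h (V - leaves V E)"
      using finite_V root_leaf by simp
    then show ?thesis using 1 by simp
  qed
  also have "\<dots> = dual_value \<mu> v"
    using marginals root_leaf unfolding dual_value_def
    by (simp add: terminals_def upward_terminal)
  finally show ?thesis .
qed

text \<open>The logarithm of \<open>c\<close> splits into a function of \<open>y\<close> and one of
  \<open>x\<close>, so the sum against \<open>N\<close> sees only the marginals. The remaining terms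
  cancel: \<open>q\<close> and \<open>q * c\<close> have the same row sums \<open>a\<close>, as both
  transition matrices are stochastic.\<close>

lemma edge_dual_term:
  fixes N :: "real ^ 'n ^ 'n"
  assumes "admissible v" "(i, j) \<in> E" "0 \<le> N" "N *v 1 = a" "transpose N *v 1 = b"
    and zero: "\<forall>y. upward v j $ y = 0 \<longrightarrow> b $ y = 0"
  defines "c \<equiv> \<lambda>x y. upward v j $ y / (A (i, j) *v upward v j) $ x"
    and "q \<equiv> \<lambda>x y. a $ x * A (i, j) $ x $ y"
  shows "(\<Sum>x\<in>UNIV. \<Sum>y\<in>UNIV. N $ x $ y * ln (c x y) + q x y - q x y * c x y) =
      (\<Sum>y\<in>UNIV. b $ y * ln (upward v j $ y))
      - (\<Sum>x\<in>UNIV. a $ x * ln ((A (i, j) *v upward v j) $ x))"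
    and "c x y = 0 \<Longrightarrow> N $ x $ y = 0"
proof -
  let ?s = "\<lambda>x. (A (i, j) *v upward v j) $ x"
  have s: "0 < ?s x" for x using edge_upward_pos assms(1,2) by blast
  have a: "a $ x = (\<Sum>y\<in>UNIV. N $ x $ y)" for x
    unfolding assms(4)[symmetric] by (simp add: matrix_vector_mult_nth)
  have b: "b $ y = (\<Sum>x\<in>UNIV. N $ x $ y)" for y
    unfolding assms(5)[symmetric] transpose_mult_nth by simp
  \<comment> \<open>The columns of the nonnegative \<open>N\<close> sum to \<open>b\<close>, so a
    zero of \<open>b\<close> clears its whole column.\<close>
  have N0: "N $ x $ y = 0" if "upward v j $ y = 0" for x y
    using zero that assms(3) by (simp add: b less_eq_vec_def sum_nonneg_eq_0_iff)
  then show "c x y = 0 \<Longrightarrow> N $ x $ y = 0"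
    using s[of x] by (simp add: c_def)
  have "N $ x $ y * ln (c x y) = N $ x $ y * ln (upward v j $ y) - N $ x $ y * ln (?s x)" for x y
    using N0[of y x] s[of x] upward_nonneg[OF assms(1), of j y]
    by (cases "upward v j $ y = 0") (auto simp: c_def ln_div algebra_simps)
  moreover have "(\<Sum>y\<in>UNIV. q x y) = a $ x" for x
  proof -
    have "(A (i, j) *v 1) $ x = 1"
      using stochastic[OF assms(2)] by (simp add: row_stochastic_def)
    then show ?thesis by (simp add: q_def matrix_vector_mult_nth flip: sum_distrib_left)
  qed
  moreover have "(\<Sum>y\<in>UNIV. q x y * c x y) = a $ x" for x
  proof -
    have "(\<Sum>y\<in>UNIV. q x y * c x y) = a $ x * ((\<Sum>y\<in>UNIV. A (i, j) $ x $ y * upward v j $ y) / ?s x)"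
      by (simp add: q_def c_def sum_distrib_left sum_divide_distrib mult.assoc)
    then show ?thesis using s[of x] by (simp add: matrix_vector_mult_nth)
  qed
  ultimately show "(\<Sum>x\<in>UNIV. \<Sum>y\<in>UNIV. N $ x $ y * ln (c x y) + q x y - q x y * c x y) =
      (\<Sum>y\<in>UNIV. b $ y * ln (upward v j $ y)) - (\<Sum>x\<in>UNIV. a $ x * ln (?s x))"
    by (simp add: sum.distrib sum_subtractf a b sum_distrib_right)
      (rule sum.swap)
qed

lemma edge_cost:
  "rel_entropy N (diag a ** A e) =
    (\<Sum>x\<in>UNIV. \<Sum>y\<in>UNIV. entropy_term (N $ x $ y) (a $ x * A e $ x $ y))"
  by (simp add: rel_entropy_def diag_mult_nth)

text \<open>Zeros of \<open>upward\<close> occur only at terminals, where the marginal is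
  prescribed.\<close>

lemma feasible_zero:
  assumes "admissible v" "sb_feasible V E \<mu> \<nu> M"
    and "\<And>l x. l \<in> terminals \<Longrightarrow> v l $ x = 0 \<Longrightarrow> \<mu> l $ x = 0"
    and "upward v j $ x = 0"
  shows "\<nu> j $ x = 0"
proof -
  have "j \<in> terminals"
    using upward_pos[OF assms(1), of j x] assms(4) by force
  then show ?thesis
    using assms(2-4) by (auto simp: sb_feasible_def terminals_def upward_terminal)
qed

lemma feasibleD:
  assumes "sb_feasible V E \<mu> \<nu> M"
  shows "\<forall>j\<in>leaves V E. \<nu> j = \<mu> j"
    and "\<And>i j. (i, j) \<in> E \<Longrightarrow> 0 \<le> M (i, j)"
    and "\<And>i j. (i, j) \<in> E \<Longrightarrow> M (i, j) *v 1 = \<nu> i"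
    and "\<And>i j. (i, j) \<in> E \<Longrightarrow> transpose (M (i, j)) *v 1 = \<nu> j"
    and "\<And>i j. (i, j) \<in> E \<Longrightarrow> 0 \<le> \<nu> i"
proof -
  show *: "\<forall>j\<in>leaves V E. \<nu> j = \<mu> j"
    "\<And>i j. (i, j) \<in> E \<Longrightarrow> 0 \<le> M (i, j)"
    "\<And>i j. (i, j) \<in> E \<Longrightarrow> M (i, j) *v 1 = \<nu> i"
    "\<And>i j. (i, j) \<in> E \<Longrightarrow> transpose (M (i, j)) *v 1 = \<nu> j"
    using assms by (auto simp: sb_feasible_def)
  fix i j assume e: "(i, j) \<in> E"
  show "0 \<le> \<nu> i"
    using *(2)[OF e] unfolding *(3)[OF e, symmetric]
    by (simp add: less_eq_vec_def matrix_vector_mult_nth sum_nonneg)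
qed

text \<open>On each edge \<open>entropy_term_ge\<close> bounds the cost by the expression in
  \<open>edge_dual_term\<close>; these bounds telescope. The condition on zeros keeps logarithms of
  0 from meeting positive mass.\<close>

lemma weak_duality:
  assumes "admissible v" "sb_feasible V E \<mu> \<nu> M"
    and zero: "\<And>l x. l \<in> terminals \<Longrightarrow> v l $ x = 0 \<Longrightarrow> \<mu> l $ x = 0"
  shows "ereal (dual_value \<mu> v) \<le> sb_cost E A \<nu> M"
proof -
  note f = feasibleD[OF assms(2)]
  have z: "\<forall>x. upward v j $ x = 0 \<longrightarrow> \<nu> j $ x = 0" for j
    using feasible_zero[OF assms] by blast
  let ?t = "\<lambda>i j. (\<Sum>y\<in>UNIV. \<nu> j $ y * ln (upward v j $ y))
      - (\<Sum>x\<in>UNIV. \<nu> i $ x * ln ((A (i, j) *v upward v j) $ x))"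
  have "ereal (?t i j) \<le> rel_entropy (M (i, j)) (diag (\<nu> i) ** A (i, j))" if e: "(i, j) \<in> E" for i j
  proof -
    note d = edge_dual_term[OF assms(1) e f(2-4)[OF e] z]
    show ?thesis
      unfolding d(1)[symmetric] edge_cost sum_ereal[symmetric]
      using f(2,5)[OF e] d(2) upward_nonneg[OF assms(1)] edge_upward_pos[OF assms(1) e] positive[OF e]
      by (intro sum_mono entropy_term_ge) (auto simp: less_eq_vec_def less_imp_le)
  qed
  then have "(\<Sum>(i, j)\<in>E. ereal (?t i j)) \<le> sb_cost E A \<nu> M"
    unfolding sb_cost_def by (intro sum_mono) auto
  then show ?thesis
    unfolding sum_edges_dual_value[OF assms(1) f(1), symmetric]
    by (simp add: case_prod_unfold)
qed

section \<open>The plan that attains the dual bound\<close>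

definition optimal_plan :: "('v \<Rightarrow> real ^ 'n) \<Rightarrow> real ^ 'n \<Rightarrow> 'v \<times> 'v \<Rightarrow> real ^ 'n ^ 'n"
  where "optimal_plan v u = (\<lambda>(i, j).
    diag (downward v u i * message v (i, j)) ** A (i, j) ** diag (upward v j))"

lemma optimal_plan_nth:
  "optimal_plan v u (i, j) $ x $ y =
    downward v u i $ x * message v (i, j) $ x * A (i, j) $ x $ y * upward v j $ y"
  by (simp add: optimal_plan_def diag_mult_nth mult_diag_nth)

text \<open>Row sums come out right by the definition of \<open>message\<close> and column sums by
  the recursion for \<open>downward\<close>, so \<open>scaling\<close> and the choice of
  \<open>u\<close> serve only the leaf marginals. The entries have the form \<open>q * c\<close>,
  which gives equality in the dual bound on every edge.\<close>

lemma optimal_plan_optimal: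
  assumes adm: "admissible v" and nonneg: "\<And>j. j \<in> leaves V E \<Longrightarrow> 0 \<le> \<mu> j"
    and zero: "\<And>l x. l \<in> terminals \<Longrightarrow> v l $ x = 0 \<Longrightarrow> \<mu> l $ x = 0"
    and u: "u = \<mu> r ./ upward v r"
    and scaling: "\<And>l. l \<in> terminals \<Longrightarrow> v l * downward v u l = \<mu> l"
  shows "sb_optimal V E A \<mu> (\<lambda>j. upward v j * downward v u j) (optimal_plan v u)"
proof -
  let ?\<nu> = "\<lambda>j. upward v j * downward v u j" and ?M = "optimal_plan v u"
  have "upward v r $ x > 0" for x
    using adm root_not_terminal by (rule upward_pos)
  then have r: "?\<nu> r = \<mu> r" and u0: "0 \<le> u"
    using nonneg[OF root_leaf]
    by (auto simp: u vec_eq_iff downward_root less_eq_vec_def less_imp_le less_imp_neq[symmetric])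
  have feas: "sb_feasible V E \<mu> ?\<nu> ?M"
  proof -
    have "?\<nu> j = \<mu> j" if "j \<in> leaves V E" for j
      using that r scaling by (cases "j = r") (auto simp: terminals_def upward_terminal)
    moreover have "0 \<le> ?\<nu> j" if "j \<in> V" for j
      using that upward_nonneg[OF adm] downward_nonneg[OF adm u0] by (simp add: less_eq_vec_def)
    moreover have "0 \<le> ?M (i, j)" if e: "(i, j) \<in> E" for i j
      using upward_nonneg[OF adm] downward_nonneg[OF adm u0 edgeD(1)[OF e]]
        message_nonneg[OF adm e] positive[OF e]
      by (simp add: less_eq_vec_def optimal_plan_nth less_imp_le)
    moreover have "?M (i, j) *v 1 = ?\<nu> i" if e: "(i, j) \<in> E" for i j
      unfolding vec_eq_iff
    proof
      fix x
      have "(?M (i, j) *v 1) $ x =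
          downward v u i $ x * message v (i, j) $ x * (A (i, j) *v upward v j) $ x"
        by (simp add: matrix_vector_mult_nth optimal_plan_nth sum_distrib_left mult.assoc)
      then show "(?M (i, j) *v 1) $ x = ?\<nu> i $ x"
        using edge_upward_pos[OF adm e, of x] by (simp add: message_def)
    qed
    moreover have "transpose (?M (i, j)) *v 1 = ?\<nu> j" if e: "(i, j) \<in> E" for i j
      unfolding downward_edge[OF e] vec_eq_iff vector_mult_component transpose_mult_nth
      by (simp add: optimal_plan_nth sum_distrib_left mult_ac)
    ultimately show ?thesis unfolding sb_feasible_def by blast
  qed
  note f = feasibleD[OF feas]
  have z: "\<forall>x. upward v j $ x = 0 \<longrightarrow> ?\<nu> j $ x = 0" for j
    by simp
  have cost: "sb_cost E A ?\<nu> ?M = ereal (dual_value \<mu> v)"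
  proof -
    let ?t = "\<lambda>i j. (\<Sum>y\<in>UNIV. ?\<nu> j $ y * ln (upward v j $ y))
      - (\<Sum>x\<in>UNIV. ?\<nu> i $ x * ln ((A (i, j) *v upward v j) $ x))"
    have "rel_entropy (?M (i, j)) (diag (?\<nu> i) ** A (i, j)) = ereal (?t i j)" if e: "(i, j) \<in> E" for i j
    proof -
      note d = edge_dual_term[OF adm e f(2-4)[OF e] z]
      have M: "?M (i, j) $ x $ y = ?\<nu> i $ x * A (i, j) $ x $ y *
          (upward v j $ y / (A (i, j) *v upward v j) $ x)" for x y
        by (simp add: optimal_plan_nth message_def)
      show ?thesis
        unfolding d(1)[symmetric] edge_cost sum_ereal[symmetric] M
        using f(5)[OF e] upward_nonneg[OF adm] edge_upward_pos[OF adm e] positive[OF e]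
        by (intro sum.cong refl entropy_term_eq) (auto simp: less_eq_vec_def less_imp_le)
    qed
    then have "sb_cost E A ?\<nu> ?M = (\<Sum>(i, j)\<in>E. ereal (?t i j))"
      unfolding sb_cost_def by (intro sum.cong) auto
    then show ?thesis
      unfolding sum_edges_dual_value[OF adm f(1), symmetric]
      by (simp add: case_prod_unfold)
  qed
  show ?thesis
    unfolding sb_optimal_def cost using feas weak_duality[of v \<mu>, OF adm _ zero] by blast
qed

section \<open>Existence of the leaf vectors\<close>

text \<open>With the zeros of \<open>m\<close> imposed on \<open>w\<close>, the maximizer of the dual value lies in the relative interior.\<close>
definition face :: "real ^ 'n \<Rightarrow> (real ^ 'n) set"
  where "face m = {w. 0 \<le> w \<and> 1 \<bullet> w = 1 \<and> (\<forall>x. m $ x = 0 \<longrightarrow> w $ x = 0)}"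

lemma compact_face: "compact (face m)"
proof -
  have "face m = cbox 0 1 \<inter> {w. 1 \<bullet> w = 1} \<inter> (\<Inter>x\<in>{x. m $ x = 0}. {w. w $ x = 0})"
  proof (intro equalityI subsetI)
    fix w assume w: "w \<in> face m"
    have "w $ x \<le> 1 \<bullet> w" for x
      using w member_le_sum[of x UNIV "\<lambda>y. w $ y"]
      by (simp add: face_def inner_vec_def less_eq_vec_def)
    then show "w \<in> cbox 0 1 \<inter> {w. 1 \<bullet> w = 1} \<inter> (\<Inter>x\<in>{x. m $ x = 0}. {w. w $ x = 0})"
      using w by (auto simp: face_def mem_box_cart less_eq_vec_def)
  qed (auto simp: face_def mem_box_cart less_eq_vec_def)
  moreover have "closed ({w. 1 \<bullet> w = 1} \<inter> (\<Inter>x\<in>{x. m $ x = 0}. {w. w $ x = 0}))"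
    by (intro closed_Int closed_INT ballI closed_Collect_eq continuous_intros)
  ultimately show ?thesis
    by (metis Int_assoc compact_Int_closed compact_cbox)
qed

lemma faceD:
  assumes "w \<in> face m"
  shows "0 \<le> w" "w \<noteq> 0" "0 \<le> w $ x" "1 \<bullet> w = 1" "m $ x = 0 \<Longrightarrow> w $ x = 0"
  using assms by (auto simp: face_def less_eq_vec_def)

text \<open>Pinning the values off the terminals to 0 makes this a product of compact sets over the
  whole vertex type, so that Tychonoff's theorem yields compactness.\<close>

definition scalings :: "('v \<Rightarrow> real ^ 'n) \<Rightarrow> ('v \<Rightarrow> real ^ 'n) set"
  where "scalings \<mu> = (\<Pi>\<^sub>E l\<in>UNIV. if l \<in> terminals then face (\<mu> l) else {0})"

lemma compact_scalings: "compact (scalings \<mu>)"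
proof -
  have "compactin (product_topology (\<lambda>_. euclidean) UNIV) (scalings \<mu>)"
    unfolding scalings_def compactin_PiE by (auto simp: compact_face)
  then show ?thesis by (simp add: euclidean_product_topology)
qed

lemma mem_scalings:
  "v \<in> scalings \<mu> \<longleftrightarrow> (\<forall>l\<in>terminals. v l \<in> face (\<mu> l)) \<and> (\<forall>l. l \<notin> terminals \<longrightarrow> v l = 0)"
proof -
  have "v l \<in> (if l \<in> terminals then face (\<mu> l) else {0}) \<longleftrightarrow>
      (l \<in> terminals \<longrightarrow> v l \<in> face (\<mu> l)) \<and> (l \<notin> terminals \<longrightarrow> v l = 0)" for l
    by simp
  then show ?thesis
    unfolding scalings_def PiE_UNIV_domain Pi_iff by blast
qed

lemma scalings_face: "v \<in> scalings \<mu> \<Longrightarrow> l \<in> terminals \<Longrightarrow> v l \<in> face (\<mu> l)"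
  by (simp add: mem_scalings)

lemma scalings_admissible: "v \<in> scalings \<mu> \<Longrightarrow> admissible v"
  unfolding admissible_def using scalings_face faceD(1,2) by blast

lemma dual_value_maximum:
  assumes nonneg: "\<And>j. j \<in> leaves V E \<Longrightarrow> 0 \<le> \<mu> j"
    and mass: "\<And>j. j \<in> leaves V E \<Longrightarrow> 1 \<bullet> \<mu> j = m" and m: "0 < m"
  obtains v where "v \<in> scalings \<mu>" "\<And>l x. l \<in> terminals \<Longrightarrow> 0 < \<mu> l $ x \<Longrightarrow> 0 < v l $ x"
    and "\<And>v'. v' \<in> scalings \<mu> \<Longrightarrow> (\<And>l x. l \<in> terminals \<Longrightarrow> 0 < \<mu> l $ x \<Longrightarrow> 0 < v' l $ x)
      \<Longrightarrow> dual_value \<mu> v' \<le> dual_value \<mu> v"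
proof -
  \<comment> \<open>the exponential of the dual value, which unlike the latter is continuous at vanishing entries\<close>
  define G where "G v = (\<Prod>l\<in>terminals. \<Prod>x\<in>{x. 0 < \<mu> l $ x}. v l $ x powr \<mu> l $ x)
    / (\<Prod>x\<in>UNIV. upward v r $ x powr \<mu> r $ x)" for v
  have up: "0 < upward v r $ x" if "v \<in> scalings \<mu>" for v x
    using scalings_admissible[OF that] root_not_terminal by (rule upward_pos)
  have up0: "upward v r $ x \<noteq> 0" if "v \<in> scalings \<mu>" for v x
    using up[OF that, of x] by simp
  have G: "G v = exp (dual_value \<mu> v)"
    if v: "v \<in> scalings \<mu>" and pos: "\<And>l x. l \<in> terminals \<Longrightarrow> 0 < \<mu> l $ x \<Longrightarrow> 0 < v l $ x" for v
  proof -
    \<comment> \<open>Entries with \<open>\<mu> l $ x = 0\<close> are left out of the product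
      because \<open>0 powr 0 = 0\<close> in HOL would make it vanish. In the sum they contribute
      nothing.\<close>
    have "(\<Prod>x\<in>{x. 0 < \<mu> l $ x}. v l $ x powr \<mu> l $ x) = exp (\<Sum>x\<in>UNIV. \<mu> l $ x * ln (v l $ x))"
      if l: "l \<in> terminals" for l
    proof -
      have "0 \<le> \<mu> l $ x" for x
        using nonneg[of l] l by (auto simp: terminals_def less_eq_vec_def)
      then have "(\<Sum>x\<in>UNIV. \<mu> l $ x * ln (v l $ x)) = (\<Sum>x\<in>{x. 0 < \<mu> l $ x}. \<mu> l $ x * ln (v l $ x))"
        by (intro sum.mono_neutral_right) (auto simp: order_less_le)
      moreover have "v l $ x \<noteq> 0" if "0 < \<mu> l $ x" for x
        using pos[OF l that] by simp
      ultimately show ?thesis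
        by (auto simp: exp_sum powr_def intro!: prod.cong)
    qed
    moreover have "(\<Prod>x\<in>UNIV. upward v r $ x powr \<mu> r $ x) =
        exp (\<Sum>x\<in>UNIV. \<mu> r $ x * ln (upward v r $ x))"
      using up0[OF v] by (simp add: exp_sum powr_def)
    ultimately show ?thesis
      using finite_terminals by (simp add: G_def dual_value_def exp_diff exp_sum)
  qed
  have cont_nth: "continuous_on S (\<lambda>v. v l $ x)" for S :: "('v \<Rightarrow> real ^ 'n) set" and l x
    by (rule continuous_on_component, rule continuous_on_subset[OF continuous_on_product_coordinates]) simp
  have "continuous_on (scalings \<mu>) G"
    unfolding G_def
  proof (intro continuous_on_divide continuous_on_prod continuous_on_powr' continuous_on_const cont_nth)
    show "continuous_on (scalings \<mu>) (\<lambda>v. upward v r $ x)" for x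
      using continuous_upward continuous_on_subset by blast
    show "\<forall>v\<in>scalings \<mu>. 0 \<le> v l $ x \<and> (v l $ x = 0 \<longrightarrow> 0 < \<mu> l $ x)"
      if "l \<in> terminals" "x \<in> {x. 0 < \<mu> l $ x}" for l x
      using that scalings_face faceD(3) by blast
    show "\<forall>v\<in>scalings \<mu>. 0 \<le> upward v r $ x \<and> (upward v r $ x = 0 \<longrightarrow> 0 < \<mu> r $ x)" for x
      using up up0 by (auto simp: less_imp_le)
    show "\<forall>v\<in>scalings \<mu>. (\<Prod>x\<in>UNIV. upward v r $ x powr \<mu> r $ x) \<noteq> 0"
      using up0 by simp
  qed
  \<comment> \<open>The normalized marginals serve as a point at which \<open>G\<close> is
    positive.\<close>
  moreover define v0 where "v0 l = (if l \<in> terminals then \<mu> l /\<^sub>R m else 0)" for l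
  have v0: "v0 \<in> scalings \<mu>"
    using nonneg mass m
    by (auto simp: mem_scalings v0_def face_def less_eq_vec_def terminals_def)
  moreover have v0_pos: "0 < v0 l $ x" if "l \<in> terminals" "0 < \<mu> l $ x" for l x
    using that m by (simp add: v0_def)
  ultimately obtain v where v: "v \<in> scalings \<mu>" and max: "\<And>v'. v' \<in> scalings \<mu> \<Longrightarrow> G v' \<le> G v"
    using continuous_attains_sup[OF compact_scalings, of \<mu> G] by blast
  \<comment> \<open>Positivity passes from \<open>v0\<close> to the maximizer, so no entry of the
    latter vanishes where \<mu> is positive.\<close>
  have "0 < G v0"
    using G[OF v0 v0_pos] by simp
  then have "0 < G v"
    using max[OF v0] by simp
  then have "(\<Prod>l\<in>terminals. \<Prod>x\<in>{x. 0 < \<mu> l $ x}. v l $ x powr \<mu> l $ x) \<noteq> 0"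
    unfolding G_def by force
  then have "v l $ x \<noteq> 0" if "l \<in> terminals" "0 < \<mu> l $ x" for l x
    using that finite_terminals by simp
  then have pos: "0 < v l $ x" if "l \<in> terminals" "0 < \<mu> l $ x" for l x
    using that scalings_face[OF v that(1)] faceD(3) by (metis order_less_le)
  show ?thesis
  proof (rule that[OF v pos])
    fix v' assume v': "v' \<in> scalings \<mu>"
      and pos': "\<And>l x. l \<in> terminals \<Longrightarrow> 0 < \<mu> l $ x \<Longrightarrow> 0 < v' l $ x"
    have "G v' = exp (dual_value \<mu> v')" "G v = exp (dual_value \<mu> v)"
      by (intro G v v' pos pos'; assumption)+
    then show "dual_value \<mu> v' \<le> dual_value \<mu> v"
      using max[OF v'] by simp
  qed
qed

section \<open>Criticality of the maximizer\<close>

lemma dual_value_upd: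
  assumes "l \<in> terminals"
  shows "dual_value \<mu> (v(l := w)) =
    (\<Sum>k\<in>terminals - {l}. \<Sum>x\<in>UNIV. \<mu> k $ x * ln (v k $ x)) + (\<Sum>x\<in>UNIV. \<mu> l $ x * ln (w $ x))
    - (\<Sum>x\<in>UNIV. \<mu> r $ x * ln (upward (v(l := w)) r $ x))"
proof -
  have "(\<Sum>k\<in>terminals - {l}. \<Sum>x\<in>UNIV. \<mu> k $ x * ln ((v(l := w)) k $ x)) =
      (\<Sum>k\<in>terminals - {l}. \<Sum>x\<in>UNIV. \<mu> k $ x * ln (v k $ x))"
    by (intro sum.cong) auto
  then show ?thesis
    unfolding dual_value_def sum.remove[OF finite_terminals assms] by simp
qed

text \<open>Since \<open>upward\<close> at the root is linear in \<open>v l\<close>, scaling changes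
  the term of \<open>l\<close> and the term of the root by the same amount \<open>m * ln c\<close>.
  This is where equality of the masses enters.\<close>

lemma dual_value_scale:
  assumes mass: "1 \<bullet> \<mu> l = m" "1 \<bullet> \<mu> r = m" and l: "l \<in> terminals"
    and "0 < c" "admissible (v(l := w))" "\<And>x. 0 \<le> \<mu> l $ x" "\<And>x. 0 < \<mu> l $ x \<Longrightarrow> 0 < w $ x"
  shows "dual_value \<mu> (v(l := c *\<^sub>R w)) = dual_value \<mu> (v(l := w))"
proof -
  have rl: "(r, l) \<in> E\<^sup>*" using l terminals_sub reachable by auto
  have "upward (v(l := c *\<^sub>R w)) r = c *\<^sub>R upward (v(l := w)) r"
    using linear_scale[OF linear_upward_upd[OF l rl]] .
  moreover have "0 < upward (v(l := w)) r $ x" for x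
    using assms(5) root_not_terminal by (rule upward_pos)
  ultimately have "(\<Sum>x\<in>UNIV. \<mu> r $ x * ln (upward (v(l := c *\<^sub>R w)) r $ x)) =
      m * ln c + (\<Sum>x\<in>UNIV. \<mu> r $ x * ln (upward (v(l := w)) r $ x))"
    using \<open>0 < c\<close> mass(2)
    by (simp add: ln_mult less_imp_neq[symmetric] distrib_left sum.distrib inner_vec_def
        flip: sum_distrib_right del: fun_upd_apply)
  moreover have "\<mu> l $ x * ln ((c *\<^sub>R w) $ x) = \<mu> l $ x * ln c + \<mu> l $ x * ln (w $ x)" for x
    using assms(4) assms(6,7)[of x] by (cases "\<mu> l $ x = 0") (auto simp: ln_mult order_less_le distrib_left)
  then have "(\<Sum>x\<in>UNIV. \<mu> l $ x * ln ((c *\<^sub>R w) $ x)) = m * ln c + (\<Sum>x\<in>UNIV. \<mu> l $ x * ln (w $ x))"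
    using mass(1) by (simp add: sum.distrib inner_vec_def flip: sum_distrib_right)
  ultimately show ?thesis
    unfolding dual_value_upd[OF l] by simp
qed

text \<open>Where \<open>\<mu> l $ x\<close> is positive, the derivative of the dual value in
  \<open>v l $ x\<close> vanishes at the maximizer, and \<open>downward_duality\<close> identifies
  the derivative of the root term. Where \<open>\<mu> l $ x = 0\<close>, the entry of
  \<open>v l\<close> is 0 and the equation is trivial.\<close>

lemma scaling_exists_pos_mass:
  assumes nonneg: "\<And>j. j \<in> leaves V E \<Longrightarrow> 0 \<le> \<mu> j"
    and mass: "\<And>j. j \<in> leaves V E \<Longrightarrow> 1 \<bullet> \<mu> j = m" and m: "0 < m"
  obtains v where "admissible v" "\<And>l x. l \<in> terminals \<Longrightarrow> v l $ x = 0 \<Longrightarrow> \<mu> l $ x = 0"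
    and "\<And>l. l \<in> terminals \<Longrightarrow> v l * downward v (\<mu> r ./ upward v r) l = \<mu> l"
proof -
  obtain v where v: "v \<in> scalings \<mu>"
    and pos: "\<And>l x. l \<in> terminals \<Longrightarrow> 0 < \<mu> l $ x \<Longrightarrow> 0 < v l $ x"
    and max: "\<And>v'. v' \<in> scalings \<mu> \<Longrightarrow> (\<And>l x. l \<in> terminals \<Longrightarrow> 0 < \<mu> l $ x \<Longrightarrow> 0 < v' l $ x)
      \<Longrightarrow> dual_value \<mu> v' \<le> dual_value \<mu> v"
    using dual_value_maximum[of \<mu> m, OF assms] by blast
  have adm: "admissible v" using v by (rule scalings_admissible)
  let ?u = "\<mu> r ./ upward v r"
  have nn: "0 \<le> \<mu> l $ x" if "l \<in> terminals" for l x
    using nonneg[of l] that by (auto simp: terminals_def less_eq_vec_def)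
  \<comment> \<open>Maximality extends to every unnormalized \<open>w\<close> with the zero pattern
    of \<open>\<mu> l\<close>, because normalizing \<open>w\<close> preserves the dual
    value.\<close>
  have upd_max: "dual_value \<mu> (v(l := w)) \<le> dual_value \<mu> v"
    if l: "l \<in> terminals" and w: "0 \<le> w" "\<And>x. 0 < \<mu> l $ x \<Longrightarrow> 0 < w $ x"
      "\<And>x. \<mu> l $ x = 0 \<Longrightarrow> w $ x = 0" for l w
  proof -
    have "\<mu> l \<noteq> 0" using mass[of l] m l by (auto simp: terminals_def)
    then obtain x where "\<mu> l $ x \<noteq> 0" by (auto simp: vec_eq_iff)
    then have x: "0 < w $ x" using nn[OF l, of x] w(2)[of x] by simp
    then have "w \<noteq> 0" by auto
    then have adm': "admissible (v(l := w))" using adm w(1) by (simp add: admissible_def)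
    have s: "0 < 1 \<bullet> w"
      using x w(1) by (auto simp: inner_vec_def less_eq_vec_def intro: sum_pos2[of _ x])
    let ?v' = "v(l := (1 / (1 \<bullet> w)) *\<^sub>R w)"
    have "(1 / (1 \<bullet> w)) *\<^sub>R w \<in> face (\<mu> l)"
      using w s by (auto simp: face_def less_eq_vec_def)
    then have "?v' \<in> scalings \<mu>"
      using v l by (auto simp: mem_scalings)
    moreover have "0 < ?v' k $ y" if "k \<in> terminals" "0 < \<mu> k $ y" for k y
      using that(1) pos[OF that] w(2)[of y] that(2) s by (cases "k = l") auto
    ultimately have "dual_value \<mu> ?v' \<le> dual_value \<mu> v" by (rule max)
    moreover have "l \<in> leaves V E" using l by (simp add: terminals_def)
    then have "dual_value \<mu> ?v' = dual_value \<mu> (v(l := w))"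
      using s by (intro dual_value_scale[OF mass mass[OF root_leaf] l _ adm' nn[OF l] w(2)]) auto
    ultimately show ?thesis by simp
  qed
  have "v l $ x * downward v ?u l $ x = \<mu> l $ x" if l: "l \<in> terminals" for l x
  proof (cases "\<mu> l $ x = 0")
    case True
    then show ?thesis using scalings_face[OF v l] faceD(5) by simp
  next
    case False
    then have mx: "0 < \<mu> l $ x" using nn[OF l, of x] by simp
    then have vx: "0 < v l $ x" using pos[OF l] by blast
    have rl: "(r, l) \<in> E\<^sup>*" using l terminals_sub reachable by auto
    define a where "a y = upward v r $ y" for y
    define b where "b y = upward (v(l := axis x 1)) r $ y" for y
    \<comment> \<open>Only the entry \<open>x\<close> of \<open>v l\<close> is varied. By linearity
      \<open>upward\<close> at the root becomes \<open>a y + t * b y\<close>, and the terms free of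
      \<open>t\<close> are collected in \<open>C\<close>.\<close>
    define w where "w t = v l + t *\<^sub>R axis x 1" for t
    have a: "0 < a y" for y
      unfolding a_def using adm root_not_terminal by (rule upward_pos)
    define C where "C = (\<Sum>k\<in>terminals - {l}. \<Sum>y\<in>UNIV. \<mu> k $ y * ln (v k $ y))
      + (\<Sum>y\<in>UNIV - {x}. \<mu> l $ y * ln (v l $ y))"
    define g where "g t = C + \<mu> l $ x * ln (v l $ x + t)
      - (\<Sum>y\<in>UNIV. \<mu> r $ y * ln (a y + t * b y))" for t
    have wx: "w t $ y = (if y = x then v l $ x + t else v l $ y)" for t y
      by (simp add: w_def axis_def)
    have g: "dual_value \<mu> (v(l := w t)) = g t" for t
    proof -
      have "upward (v(l := w t)) r = upward (v(l := v l)) r + t *\<^sub>R upward (v(l := axis x 1)) r"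
        unfolding w_def
        by (simp only: linear_add[OF linear_upward_upd[OF l rl]] linear_scale[OF linear_upward_upd[OF l rl]])
      then have "upward (v(l := w t)) r $ y = a y + t * b y" for y
        by (simp add: a_def b_def)
      moreover have "(\<Sum>y\<in>UNIV. \<mu> l $ y * ln (w t $ y)) =
          \<mu> l $ x * ln (v l $ x + t) + (\<Sum>y\<in>UNIV - {x}. \<mu> l $ y * ln (v l $ y))"
        by (simp add: sum.remove[of _ x] wx)
      ultimately show ?thesis
        unfolding dual_value_upd[OF l] by (simp add: g_def C_def)
    qed
    \<comment> \<open>For such \<open>t\<close> the entry \<open>x\<close> of \<open>w t\<close>
      stays positive, so \<open>w t\<close> is an allowed competitor.\<close>
    have g_max: "g t \<le> g 0" if "\<bar>0 - t\<bar> < v l $ x" for t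
    proof -
      have "dual_value \<mu> (v(l := w t)) \<le> dual_value \<mu> v"
      proof (rule upd_max[OF l])
        show "0 \<le> w t"
          using that faceD(3)[OF scalings_face[OF v l]] by (auto simp: less_eq_vec_def wx)
        show "0 < w t $ y" if "0 < \<mu> l $ y" for y
          using pos[OF l that] \<open>\<bar>0 - t\<bar> < v l $ x\<close> by (auto simp: wx)
        show "w t $ y = 0" if "\<mu> l $ y = 0" for y
          using that mx faceD(5)[OF scalings_face[OF v l]] by (auto simp: wx)
      qed
      also have "dual_value \<mu> v = g 0"
        using g[of 0] by (simp add: w_def)
      finally show ?thesis unfolding g .
    qed
    have deriv: "(g has_real_derivative \<mu> l $ x / v l $ x - (\<Sum>y\<in>UNIV. \<mu> r $ y * (b y / a y))) (at 0)"
      unfolding g_def using vx a by (auto intro!: derivative_eq_intros simp: divide_inverse mult.commute)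
    have "\<mu> l $ x / v l $ x - (\<Sum>y\<in>UNIV. \<mu> r $ y * (b y / a y)) = 0"
      by (rule DERIV_local_max[OF deriv vx]) (use g_max in blast)
    then have "\<mu> l $ x / v l $ x = (\<Sum>y\<in>UNIV. \<mu> r $ y * (b y / a y))"
      by simp
    \<comment> \<open>By the choice of the root value, \<open>\<mu> r $ y / a y\<close> is the entry
      \<open>y\<close> of \<open>downward\<close> at the root.\<close>
    also have "\<dots> = downward v ?u r \<bullet> upward (v(l := axis x 1)) r"
      by (simp add: downward_root inner_vec_def a_def b_def)
    also have "\<dots> = downward v ?u l $ x"
      unfolding downward_duality[OF adm l rl] by (simp add: inner_axis)
    finally show ?thesis using vx by (simp add: field_simps)
  qed
  moreover have "\<mu> l $ x = 0" if "l \<in> terminals" "v l $ x = 0" for l x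
    using that pos[of l x] nn[of l x] by force
  ultimately show ?thesis
    using that[OF adm] by (simp add: vec_eq_iff)
qed

lemma scaling_exists:
  assumes nonneg: "\<And>j. j \<in> leaves V E \<Longrightarrow> 0 \<le> \<mu> j"
    and mass: "\<And>i j. i \<in> leaves V E \<Longrightarrow> j \<in> leaves V E \<Longrightarrow> 1 \<bullet> \<mu> i = 1 \<bullet> \<mu> j"
  obtains v where "admissible v" "\<And>l x. l \<in> terminals \<Longrightarrow> v l $ x = 0 \<Longrightarrow> \<mu> l $ x = 0"
    and "\<And>l. l \<in> terminals \<Longrightarrow> v l * downward v (\<mu> r ./ upward v r) l = \<mu> l"
proof (cases "1 \<bullet> \<mu> r = 0")
  case False
  have "0 \<le> 1 \<bullet> \<mu> r"
    using nonneg[OF root_leaf] by (simp add: inner_vec_def less_eq_vec_def sum_nonneg)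
  with False have "0 < 1 \<bullet> \<mu> r" by simp
  with nonneg mass[OF _ root_leaf] show ?thesis
    using that by (rule scaling_exists_pos_mass)
next
  case True
  then have zero: "\<mu> j = 0" if "j \<in> leaves V E" for j
    using mass[OF that root_leaf] nonneg[OF that]
    by (simp add: inner_vec_def less_eq_vec_def vec_eq_iff sum_nonneg_eq_0_iff)
  \<comment> \<open>Here all leaf marginals vanish. Then the root value and with it
    \<open>downward\<close> are 0 on the whole tree, so any admissible \<open>v\<close> would
    do.\<close>
  define v :: "'v \<Rightarrow> real ^ 'n" where "v l = 1" for l
  have "admissible v"
    by (simp add: admissible_def v_def less_eq_vec_def)
  moreover have "downward v (\<mu> r ./ upward v r) j = 0" if "j \<in> V" for j
    using that
  proof (induction rule: tree_induct)
    case root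
    then show ?case using zero[OF root_leaf] by (simp add: downward_root vec_eq_iff)
  next
    case (edge i j)
    then show ?case by (simp add: downward_edge)
  qed
  ultimately show ?thesis
    using that[of v] zero terminals_sub by (auto simp: terminals_def v_def)
qed

end

section \<open>The theorem for vertices 1 to J with root 1\<close>

theorem theorem4p1:
  fixes J :: nat and V L :: "nat set" and E :: "(nat \<times> nat) set"
    and A :: "nat \<times> nat \<Rightarrow> real ^ 'n ^ 'n" and \<mu> :: "nat \<Rightarrow> real ^ 'n"
  defines "V \<equiv> {1..J}"
  defines "L \<equiv> leaves V E"
  assumes tree: "rooted_tree V E 1"
    and root_leaf: "1 \<in> L"
    and stochastic: "\<And>e. e \<in> E \<Longrightarrow> row_stochastic (A e)"
    and positive: "\<And>e i j. e \<in> E \<Longrightarrow> 0 < A e $ i $ j"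
    and nonneg: "\<And>j. j \<in> L \<Longrightarrow> 0 \<le> \<mu> j"
    and mass: "\<And>j\<^sub>1 j\<^sub>2. j\<^sub>1 \<in> L \<Longrightarrow> j\<^sub>2 \<in> L \<Longrightarrow> 1 \<bullet> \<mu> j\<^sub>1 = 1 \<bullet> \<mu> j\<^sub>2"
  shows "\<exists>\<nu> M. sb_optimal V E A \<mu> \<nu> M \<and>
    (\<exists>(\<phi> :: nat \<Rightarrow> real ^ 'n) (\<phi>h :: nat \<Rightarrow> real ^ 'n) (\<psi> :: nat \<times> nat \<Rightarrow> real ^ 'n).
      (\<forall>j\<in>V. \<nu> j = \<phi> j * \<phi>h j) \<and>
      (\<forall>(j\<^sub>1, j\<^sub>2)\<in>E. M (j\<^sub>1, j\<^sub>2) =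
        diag (\<phi>h j\<^sub>1 * \<psi> (j\<^sub>1, j\<^sub>2)) ** A (j\<^sub>1, j\<^sub>2) ** diag (\<phi> j\<^sub>2)) \<and>
      (\<exists>v :: nat \<Rightarrow> real ^ 'n.
        (\<forall>j\<in>V. \<phi> j =
          (if j \<in> L - {1} then v j else \<Prod>k\<in>{k. (j, k) \<in> E}. A (j, k) *v \<phi> k)) \<and>
        (\<forall>j\<in>V. \<phi>h j =
          (if j = 1 then 1 ./ v 1
           else transpose (A (parent E j, j)) *v (\<phi>h (parent E j) * \<psi> (parent E j, j)))) \<and>
        (\<forall>(j\<^sub>1, j\<^sub>2)\<in>E. \<psi> (j\<^sub>1, j\<^sub>2) = \<phi> j\<^sub>1 ./ (A (j\<^sub>1, j\<^sub>2) *v \<phi> j\<^sub>2))))"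
proof -
  interpret tree_bridge V E 1 A
    using tree root_leaf stochastic positive unfolding L_def by unfold_locales
  obtain v where adm: "admissible v"
    and zero: "\<And>l x. l \<in> terminals \<Longrightarrow> v l $ x = 0 \<Longrightarrow> \<mu> l $ x = 0"
    and scaling: "\<And>l. l \<in> terminals \<Longrightarrow> v l * downward v (\<mu> 1 ./ upward v 1) l = \<mu> l"
    using scaling_exists[of \<mu>, OF nonneg mass] unfolding L_def by blast
  define u where "u = \<mu> 1 ./ upward v 1"
  \<comment> \<open>where \<open>\<mu> 1\<close> vanishes, so does \<open>v' 1\<close> because \<open>x / 0 = 0\<close>, and then \<open>1 ./ v' 1\<close> vanishes as well\<close>
  define v' where "v' = v(1 := upward v 1 ./ \<mu> 1)"
  have u: "u = 1 ./ v' 1"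
    by (simp add: u_def v'_def vec_eq_iff)
  \<comment> \<open>The root is not a terminal, so \<open>v'\<close> agrees with \<open>v\<close>
    wherever the recursion for \<open>upward\<close> reads leaf values.\<close>
  have "\<forall>j\<in>V. upward v j =
      (if j \<in> L - {1} then v' j else \<Prod>k\<in>{k. (j, k) \<in> E}. A (j, k) *v upward v k)"
    using root_not_terminal
    by (auto simp: upward_terminal upward_inner v'_def terminals_def L_def simp del: One_nat_def)
  moreover have "\<forall>j\<in>V. downward v u j = (if j = 1 then 1 ./ v' 1
      else transpose (A (parent E j, j)) *v (downward v u (parent E j) * message v (parent E j, j)))"
    using downward_edge[OF parent_edge] by (auto simp: downward_root u simp del: transpose_matrix_vector One_nat_def)
  moreover have "\<forall>(i, j)\<in>E. message v (i, j) = upward v i ./ (A (i, j) *v upward v j)"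
    by (auto simp: message_def simp del: One_nat_def)
  moreover have "\<forall>(i, j)\<in>E. optimal_plan v u (i, j) =
      diag (downward v u i * message v (i, j)) ** A (i, j) ** diag (upward v j)"
    by (auto simp: optimal_plan_def simp del: One_nat_def)
  moreover have "sb_optimal V E A \<mu> (\<lambda>j. upward v j * downward v u j) (optimal_plan v u)"
    using adm nonneg[unfolded L_def] zero u_def scaling[folded u_def] by (rule optimal_plan_optimal)
  ultimately show ?thesis
    by (intro exI[of _ "\<lambda>j. upward v j * downward v u j"] exI[of _ "optimal_plan v u"]
        exI[of _ "upward v"] exI[of _ "downward v u"] exI[of _ "message v"] exI[of _ v'] conjI)
      (assumption | simp)+
qed

end
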